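(* Let $d\in\mathbb{N}$, let $I\subset\mathbb{N}_0^d$ be a nonempty finite set, and let $\mathscr{M}(I)\subset\mathbb{Z}^d$ be the corresponding mirrored set. Fix $c>1$ and $\delta\in(0,1]$. Let $\lambda$ be a real number and $L$ an integer with $$\lambda\ge c\,(|\mathscr{M}(I)|-1),\qquad L\ge\left\lceil\left(\frac{c}{c-1}\right)^2\frac{\ln|I|-\ln\delta}{2}\right\rceil,$$ and let $M\ge\lambda$ be a prime number such that $|\mathscr{M}(I)_{\bmod M}|=|\mathscr{M}(I)|$. Draw $L$ generating vectors $\boldsymbol{z}_1,\dots,\boldsymbol{z}_L\in[0,M-1]^d\cap\mathbb{Z}^d$ i.i.d. uniformly at random. Then, with probability at least $1-\delta$, all Chebyshev coefficients $(\hat c_{\boldsymbol k})_{\boldsymbol k\in I}$ of every polynomial $P=\sum_{\boldsymbol k\in I}\hat c_{\boldsymbol k}T_{\boldsymbol k}$ can be uniquely reconstructed from the sampling values of $P$ at the nodes of $$\mathcal{X}=\bigcup_{\ell=1}^L\{\cos(2\pi\boldsymbol t)\colon\boldsymbol t\in\Lambda(\boldsymbol z_\ell,M)\};$$ that is, with probability at least $1-\delta$ the matrix $\boldsymbol C(\mathcal X,I)=(T_{\boldsymbol k}(\boldsymbol x))_{\boldsymbol x\in\mathcal X,\boldsymbol k\in I}$ has full column rank $|I|$.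
   Context: Univariate Chebyshev polynomials: $T_0(x)=1$ and $T_k(x)=\sqrt2\cos(k\arccos x)$ for $k\in\mathbb{N}$, $x\in[-1,1]$. Multivariate: $T_{\boldsymbol k}(\boldsymbol x)=\prod_{j=1}^dT_{k_j}(x_j)$ for $\boldsymbol k\in\mathbb{N}_0^d$, $\boldsymbol x\in[-1,1]^d$. Mirrored set: $\mathscr{M}(I)=\{(l_1k_1,\dots,l_dk_d)^\top\colon\boldsymbol k\in I,\ \boldsymbol l\in\{-1,1\}^d\}\subset\mathbb{Z}^d$. For $J\subset\mathbb{Z}^d$ and $M\in\mathbb{N}$: $J_{\bmod M}=\{\boldsymbol h\bmod M\colon\boldsymbol h\in J\}\subset[0,M-1]^d\cap\mathbb{Z}^d$ (componentwise residues). Rank-1 lattice with generating vector $\boldsymbol z\in\mathbb{Z}^d$ and size $M\in\mathbb{N}$: $\Lambda(\boldsymbol z,M)=\{\frac jM\boldsymbol z\bmod\boldsymbol 1\colon j=0,\dots,M-1\}\subset\mathbb{T}^d$, where $\mathbb{T}=\mathbb{R}/\mathbb{Z}$. The cosine is applied componentwise. *)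

theory Defs
  imports "HOL-Probability.Probability" "Jordan_Normal_Form.DL_Rank"
begin

(* Throughout, $ is the component of a vector of type _ ^ 'd; the dimension is CARD('d). *)
no_notation Matrix.vec_index (infixl \<open>$\<close> 100)

definition cheb_uni :: "nat \<Rightarrow> real \<Rightarrow> real" where
  "cheb_uni k x = (if k = 0 then 1 else sqrt 2 * cos (real k * arccos x))"

definition cheb :: "nat ^ 'd \<Rightarrow> real ^ 'd \<Rightarrow> real" where
  "cheb k x = (\<Prod>j\<in>UNIV. cheb_uni (k $ j) (x $ j))"

definition cheb_poly :: "(nat ^ 'd) set \<Rightarrow> (nat ^ 'd \<Rightarrow> real) \<Rightarrow> real ^ 'd \<Rightarrow> real" where
  "cheb_poly I a x = (\<Sum>k\<in>I. a k * cheb k x)"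

definition mirrored :: "(nat ^ 'd) set \<Rightarrow> (int ^ 'd) set" where
  "mirrored I = {(\<chi> j. l $ j * int (k $ j)) | k l. k \<in> I \<and> (\<forall>j. l $ j \<in> {-1, 1})}"

definition mod_set :: "(int ^ 'd) set \<Rightarrow> nat \<Rightarrow> (int ^ 'd) set" where
  "mod_set J M = (\<lambda>h. \<chi> j. h $ j mod int M) ` J"

definition residue_box :: "nat \<Rightarrow> (int ^ 'd) set" where
  "residue_box M = {z. \<forall>j. z $ j \<in> {0..int M - 1}}"

(* Points of the torus (R/Z)^d are represented by their representatives in [0,1)^d. *)
definition rank1_lattice :: "int ^ 'd \<Rightarrow> nat \<Rightarrow> (real ^ 'd) set" where
  "rank1_lattice z M = (\<lambda>j. \<chi> i. frac (real j / real M * real_of_int (z $ i))) ` {0..<M}"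

definition cheb_nodes :: "nat \<Rightarrow> int \<Rightarrow> (int \<Rightarrow> int ^ 'd) \<Rightarrow> (real ^ 'd) set" where
  "cheb_nodes M L z = (\<Union>l\<in>{1..L}. (\<lambda>t. \<chi> i. cos (2 * pi * t $ i)) ` rank1_lattice (z l) M)"

(* The matrix C(X,I), with rows and columns ordered by enumerations xs of X and ks of I. *)
definition cheb_matrix :: "(real ^ 'd) list \<Rightarrow> (nat ^ 'd) list \<Rightarrow> real mat" where
  "cheb_matrix xs ks = mat (length xs) (length ks) (\<lambda>(i, j). cheb (ks ! j) (xs ! i))"

(* The rank does not depend on the enumerations; finiteness guarantees that they exist. *)
definition full_column_rank :: "(real ^ 'd) set \<Rightarrow> (nat ^ 'd) set \<Rightarrow> bool" where
  "full_column_rank X I \<longleftrightarrow> finite X \<and> finite I \<and>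
     (\<forall>xs ks. distinct xs \<and> set xs = X \<and> distinct ks \<and> set ks = I \<longrightarrow>
        vec_space.rank (length xs) (cheb_matrix xs ks) = card I)"

definition uniquely_reconstructible :: "(real ^ 'd) set \<Rightarrow> (nat ^ 'd) set \<Rightarrow> bool" where
  "uniquely_reconstructible X I \<longleftrightarrow>
     (\<forall>a b. (\<forall>x\<in>X. cheb_poly I a x = cheb_poly I b x) \<longrightarrow> (\<forall>k\<in>I. a k = b k))"

end

theory Submission
  imports Defs "HOL-Number_Theory.Cong"
begin

text \<open>
  At \<open>cos (2\<pi>t)\<close> the polynomial \<open>T\<^sub>k\<close> is a positive multiple of the sum of the exponentials
  \<open>exp (2\<pi>i h\<cdot>t)\<close> over the sign changes \<open>h\<close> of \<open>k\<close>. Averaging \<open>P (cos (2\<pi>t)) exp (-2\<pi>i k\<cdot>t)\<close> over a lattice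
  with generating vector \<open>v\<close> therefore isolates the coefficient of \<open>T\<^sub>k\<close>, unless some \<open>h\<close> in the mirrored
  set that is not a sign change of \<open>k\<close> satisfies \<open>h\<cdot>v \<equiv> k\<cdot>v (mod M)\<close>. For a random \<open>v\<close> and prime \<open>M\<close>
  each such coincidence has probability at most \<open>1/M\<close>, so one lattice fails for \<open>k\<close> with probability at
  most \<open>1/c\<close>, and by independence all \<open>L\<close> fail with probability at most \<open>c\<^sup>-\<^sup>L\<close>. Since
  \<open>ln c \<ge> 2 ((c - 1)/c)\<^sup>2\<close>, the bound on \<open>L\<close> gives \<open>|I| c\<^sup>-\<^sup>L \<le> \<delta>\<close>, and a union bound over \<open>k \<in> I\<close>
  suffices; no concentration inequality is needed.
\<close>

section \<open>Chebyshev polynomials at cosine nodes as exponential sums\<close>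

text \<open>\<open>arccos (cos t)\<close> is \<open>t\<close> or \<open>- t\<close> up to a multiple
  of \<open>2 * pi\<close>. A natural factor \<open>k\<close> keeps that multiple integral, and
  cosine is even.\<close>

lemma cos_of_nat_mult_arccos_cos: "cos (real k * arccos (cos t)) = cos (real k * t)"
proof -
  have "cos (arccos (cos t)) = cos t"
    by (simp add: cos_arccos)
  then obtain m :: int
    where "arccos (cos t) = t + 2 * real_of_int m * pi \<or> arccos (cos t) = - t + 2 * real_of_int m * pi"
    unfolding cos_eq by (auto elim: Ints_cases)
  then have "real k * arccos (cos t) = real k * t + 2 * (real k * real_of_int m) * pi \<or>
      real k * arccos (cos t) = - (real k * t) + 2 * (real k * real_of_int m) * pi"
  proof (elim disjE)
    assume eq: "arccos (cos t) = t + 2 * real_of_int m * pi"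
    show ?thesis
      by (rule disjI1) (unfold eq, simp add: algebra_simps)
  next
    assume eq: "arccos (cos t) = - t + 2 * real_of_int m * pi"
    show ?thesis
      by (rule disjI2) (unfold eq, simp add: algebra_simps)
  qed
  moreover have "real k * real_of_int m \<in> \<int>"
    by simp
  ultimately show ?thesis
    unfolding cos_eq by blast
qed

lemma cos_2pi_frac: "cos (2 * pi * frac y) = cos (2 * pi * y)"
  unfolding cos_eq frac_def
  by (rule bexI[of _ "- real_of_int \<lfloor>y\<rfloor>"]) (simp_all add: algebra_simps)

definition cheb_weight :: "nat ^ 'd \<Rightarrow> real" where
  "cheb_weight k = (\<Prod>j\<in>UNIV. if k $ j = 0 then 1 else sqrt 2)"

lemma cheb_weight_pos: "cheb_weight k > 0"
  unfolding cheb_weight_def by (rule prod_pos) simp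

lemma cheb_cos_frac:
  "cheb k (\<chi> i. cos (2 * pi * frac (y i))) =
     cheb_weight k * (\<Prod>i\<in>UNIV. cos (real (k $ i) * (2 * pi * y i)))"
  unfolding cheb_def cheb_weight_def prod.distrib[symmetric]
  by (rule prod.cong) (simp_all add: cheb_uni_def cos_2pi_frac cos_of_nat_mult_arccos_cos)

lemma cis_sum: "finite A \<Longrightarrow> cis (\<Sum>i\<in>A. x i) = (\<Prod>i\<in>A. cis (x i))"
  by (induction A rule: finite_induct) (simp_all add: cis_mult[symmetric])

text \<open>Write each cosine as the mean of \<open>cis t\<close> and \<open>cis (- t)\<close> and
  multiply out; \<open>S\<close> collects the coordinates where the plus sign is chosen.\<close>

lemma prod_cos_eq_sum_cis:
  fixes x :: "'d::finite \<Rightarrow> real"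
  shows "complex_of_real (\<Prod>i\<in>UNIV. cos (x i)) =
    (\<Sum>S\<in>UNIV. cis (\<Sum>i\<in>UNIV. (if i \<in> S then 1 else - 1) * x i)) / 2 ^ CARD('d)"
proof -
  have cos_cis: "complex_of_real (cos t) = (cis t + cis (- t)) / 2" for t
    by (simp add: complex_eq_iff)
  have "(\<Prod>i\<in>S. cis (x i)) * (\<Prod>i\<in>UNIV - S. cis (- x i)) =
      cis (\<Sum>i\<in>UNIV. (if i \<in> S then 1 else - 1) * x i)" for S
  proof -
    have "(\<Prod>i\<in>UNIV. cis ((if i \<in> S then 1 else - 1) * x i)) =
        (\<Prod>i\<in>UNIV - S. cis ((if i \<in> S then 1 else - 1) * x i)) *
        (\<Prod>i\<in>S. cis ((if i \<in> S then 1 else - 1) * x i))"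
      by (rule prod.subset_diff) auto
    also have "\<dots> = (\<Prod>i\<in>UNIV - S. cis (- x i)) * (\<Prod>i\<in>S. cis (x i))"
      by (intro arg_cong2[of _ _ _ _ "(*)"] prod.cong) auto
    finally show ?thesis
      by (simp add: cis_sum mult.commute)
  qed
  then show ?thesis
    by (simp add: cos_cis prod_dividef prod_add)
qed

text \<open>The summands are the powers of an \<open>M\<close>-th root of unity, so this is a
  geometric sum; the root equals 1 exactly in the divisible case.\<close>

lemma sum_cis_roots_of_unity:
  fixes m :: int and M :: nat
  assumes "M > 0"
  shows "(\<Sum>j<M. cis (2 * pi * (real j / real M * real_of_int m))) = (if int M dvd m then of_nat M else 0)"
proof -
  define w where "w = cis (2 * pi * (real_of_int m / real M))"
  have pow: "cis (2 * pi * (real j / real M * real_of_int m)) = w ^ j" for j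
    unfolding w_def by (subst Complex.DeMoivre, rule arg_cong[of _ _ cis]) (simp add: field_simps)
  have w1: "w = 1 \<longleftrightarrow> int M dvd m"
  proof
    assume "w = 1"
    then have "cos (2 * pi * (real_of_int m / real M)) = 1"
      unfolding w_def by (simp add: complex_eq_iff)
    then obtain n :: int where "2 * pi * (real_of_int m / real M) = real_of_int n * 2 * pi"
      unfolding cos_one_2pi_int by blast
    then have "real_of_int m = real_of_int (n * int M)"
      using assms by (simp add: field_simps)
    then show "int M dvd m"
      unfolding of_int_eq_iff by simp
  next
    assume "int M dvd m"
    then obtain n where "m = int M * n" by blast
    then show "w = 1"
      using assms by (simp add: w_def)
  qed
  have wM: "w ^ M = 1"
    using assms by (simp add: w_def Complex.DeMoivre)
  show ?thesis
  proof (cases "w = 1")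
    case True
    then show ?thesis unfolding pow using w1 by simp
  next
    case False
    then show ?thesis unfolding pow using w1 wM by (simp add: geometric_sum)
  qed
qed

section \<open>Lattice averages and recovery of coefficients\<close>

text \<open>Sign patterns are indexed by sets to match the expansion of the cosine product. If
  \<open>k\<close> has zero entries, several \<open>S\<close> give the same vector, so sums over
  \<open>S\<close> count with multiplicity.\<close>

definition signed_vec :: "'d set \<Rightarrow> nat ^ 'd \<Rightarrow> int ^ 'd" where
  "signed_vec S k = (\<chi> i. (if i \<in> S then 1 else - 1) * int (k $ i))"

lemma signed_vec_in_mirrored: "k \<in> I \<Longrightarrow> signed_vec S k \<in> mirrored I"
  unfolding signed_vec_def mirrored_def
  by (auto intro!: exI[of _ "k"] exI[of _ "\<chi> i. if i \<in> S then 1 else - 1"] simp: Finite_Cartesian_Product.vec_eq_iff)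

text \<open>Absolute values of the entries recover the index, so different indices have disjoint
  sets of sign changes.\<close>

lemma signed_vec_in_mirrored_singleton_iff:
  fixes k k' :: "nat ^ 'd"
  shows "signed_vec S k' \<in> mirrored {k} \<longleftrightarrow> k' = k"
proof
  assume "signed_vec S k' \<in> mirrored {k}"
  then obtain l :: "int ^ 'd" where l: "\<forall>j. l $ j \<in> {-1, 1}"
    and eq: "signed_vec S k' = (\<chi> j. l $ j * int (k $ j))"
    unfolding mirrored_def by blast
  have coord: "(if i \<in> S then 1 else - 1) * int (k' $ i) = l $ i * int (k $ i)" for i
    using arg_cong[OF eq, of "\<lambda>h. h $ i"] by (simp add: signed_vec_def)
  have "int (k' $ i) = int (k $ i)" for i
    using coord[of i] spec[OF l, of i] by (auto split: if_splits)
  then show "k' = k"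
    by (simp add: Finite_Cartesian_Product.vec_eq_iff)
qed (simp add: signed_vec_in_mirrored)

lemma signed_vec_UNIV: "signed_vec UNIV k = (\<chi> i. int (k $ i))"
  by (simp add: signed_vec_def)

text \<open>Indexing by \<open>j\<close> keeps repeated nodes apart, so a lattice average is always
  a full sum over \<open>M\<close> terms, even if the lattice as a set is smaller.\<close>

definition lattice_node :: "int ^ 'd \<Rightarrow> nat \<Rightarrow> nat \<Rightarrow> real ^ 'd" where
  "lattice_node v M j = (\<chi> i. cos (2 * pi * frac (real j / real M * real_of_int (v $ i))))"

lemma cheb_nodes_eq: "cheb_nodes M L z = (\<Union>l\<in>{1..L}. lattice_node (z l) M ` {..<M})"
  unfolding cheb_nodes_def rank1_lattice_def image_image lattice_node_def
  by (simp add: lessThan_atLeast0)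

text \<open>Orthogonality of characters: a sign pattern survives the sum over \<open>j\<close>
  exactly when its frequency on the lattice agrees with \<open>m\<close> modulo
  \<open>M\<close>.\<close>

lemma lattice_sum_cheb:
  fixes k :: "nat ^ 'd" and m :: int
  assumes "M > 0"
  shows "(\<Sum>j<M. complex_of_real (cheb k (lattice_node v M j)) * cis (- (2 * pi * (real j / real M * real_of_int m)))) =
    of_real (cheb_weight k) * of_nat M *
      of_nat (card {S. int M dvd (\<Sum>i\<in>UNIV. signed_vec S k $ i * v $ i) - m}) / 2 ^ CARD('d)"
proof -
  have phase: "cis (\<Sum>i\<in>UNIV. (if i \<in> S then 1 else - 1) * (real (k $ i) * (2 * pi * (real j / real M * real_of_int (v $ i)))))
      * cis (- (2 * pi * (real j / real M * real_of_int m))) =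
      cis (2 * pi * (real j / real M * real_of_int ((\<Sum>i\<in>UNIV. signed_vec S k $ i * v $ i) - m)))" for S j
  proof -
    have "(\<Sum>i\<in>UNIV. (if i \<in> S then 1 else - 1) * (real (k $ i) * (2 * pi * (real j / real M * real_of_int (v $ i)))))
      = 2 * pi * (real j / real M * real_of_int (\<Sum>i\<in>UNIV. signed_vec S k $ i * v $ i))"
      unfolding of_int_sum sum_distrib_left by (rule sum.cong) (simp_all add: signed_vec_def)
    then show ?thesis
      by (simp add: cis_mult algebra_simps)
  qed
  have "(\<Sum>j<M. complex_of_real (cheb k (lattice_node v M j)) * cis (- (2 * pi * (real j / real M * real_of_int m)))) =
    (\<Sum>j<M. \<Sum>S\<in>UNIV. of_real (cheb_weight k) / 2 ^ CARD('d) *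
      cis (2 * pi * (real j / real M * real_of_int ((\<Sum>i\<in>UNIV. signed_vec S k $ i * v $ i) - m))))"
    unfolding lattice_node_def cheb_cos_frac of_real_mult prod_cos_eq_sum_cis phase[symmetric]
    by (simp add: sum_distrib_left sum_distrib_right sum_divide_distrib mult.assoc)
  also have "\<dots> = of_real (cheb_weight k) / 2 ^ CARD('d) *
      (\<Sum>S\<in>UNIV. \<Sum>j<M. cis (2 * pi * (real j / real M * real_of_int ((\<Sum>i\<in>UNIV. signed_vec S k $ i * v $ i) - m))))"
    unfolding sum_distrib_left by (rule sum.swap)
  also have "\<dots> = of_real (cheb_weight k) * of_nat M *
      of_nat (card {S. int M dvd (\<Sum>i\<in>UNIV. signed_vec S k $ i * v $ i) - m}) / 2 ^ CARD('d)"
    unfolding sum_cis_roots_of_unity[OF assms] by (simp add: sum.If_cases)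
  finally show ?thesis .
qed

text \<open>Sign changes of \<open>k\<close> itself are left out: a coincidence among them only
  enlarges the positive factor in front of the coefficient at \<open>k\<close>.\<close>

definition aliasing_set :: "nat \<Rightarrow> (nat ^ 'd) set \<Rightarrow> nat ^ 'd \<Rightarrow> (int ^ 'd) set" where
  "aliasing_set M I k = (\<Union>h\<in>mirrored I - mirrored {k}.
     {v. int M dvd (\<Sum>i\<in>UNIV. (h $ i - int (k $ i)) * v $ i)})"

lemma coefficient_zero:
  fixes I :: "(nat ^ 'd) set" and v :: "int ^ 'd"
  assumes "finite I" "k \<in> I" "M > 0" and noalias: "v \<notin> aliasing_set M I k"
    and zero: "\<And>j. j < M \<Longrightarrow> cheb_poly I a (lattice_node v M j) = 0"
  shows "a k = 0"
proof -
  define m where "m = (\<Sum>i\<in>UNIV. int (k $ i) * v $ i)"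
  define n where "n k' = card {S. int M dvd (\<Sum>i\<in>UNIV. signed_vec S k' $ i * v $ i) - m}" for k'
  have n0: "n k' = 0" if "k' \<in> I" "k' \<noteq> k" for k'
  proof -
    have "\<not> int M dvd (\<Sum>i\<in>UNIV. signed_vec S k' $ i * v $ i) - m" for S
    proof -
      have "signed_vec S k' \<in> mirrored I - mirrored {k}"
        using that by (simp add: signed_vec_in_mirrored signed_vec_in_mirrored_singleton_iff)
      then show ?thesis
        using noalias by (auto simp: aliasing_set_def m_def left_diff_distrib sum_subtractf)
    qed
    then show ?thesis by (simp add: n_def)
  qed
  \<comment> \<open>The all-plus pattern gives \<open>k\<close> itself, whose frequency is
    \<open>m\<close> by definition, so the coefficient at \<open>k\<close> is not multiplied by
    zero.\<close>
  have "UNIV \<in> {S. int M dvd (\<Sum>i\<in>UNIV. signed_vec S k $ i * v $ i) - m}"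
    by (simp add: signed_vec_UNIV m_def)
  then have nk: "n k \<noteq> 0"
    unfolding n_def by auto
  have "0 = (\<Sum>j<M. complex_of_real (cheb_poly I a (lattice_node v M j)) * cis (- (2 * pi * (real j / real M * real_of_int m))))"
    using zero by simp
  also have "\<dots> = (\<Sum>j<M. \<Sum>k'\<in>I. of_real (a k') * (complex_of_real (cheb k' (lattice_node v M j)) * cis (- (2 * pi * (real j / real M * real_of_int m)))))"
    by (simp add: cheb_poly_def sum_distrib_right mult.assoc)
  also have "\<dots> = (\<Sum>k'\<in>I. of_real (a k') * (\<Sum>j<M. complex_of_real (cheb k' (lattice_node v M j)) * cis (- (2 * pi * (real j / real M * real_of_int m)))))"
    unfolding sum_distrib_left by (rule sum.swap)
  also have "\<dots> = (\<Sum>k'\<in>I. of_real (a k') * (of_real (cheb_weight k') * of_nat M * of_nat (n k') / 2 ^ CARD('d)))"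
    unfolding lattice_sum_cheb[OF \<open>M > 0\<close>] n_def ..
  also have "\<dots> = of_real (a k) * (of_real (cheb_weight k) * of_nat M * of_nat (n k) / 2 ^ CARD('d))"
    using n0 by (subst sum.remove[OF \<open>finite I\<close> \<open>k \<in> I\<close>]) simp
  finally show ?thesis
    using nk \<open>M > 0\<close> cheb_weight_pos[of k] by simp
qed

text \<open>Each coefficient may be read off from its own lattice; no single lattice has to serve
  all of \<open>I\<close>. By linearity it suffices to treat the differences
  \<open>a k - b k\<close>.\<close>

lemma uniquely_reconstructible_if_not_aliasing:
  fixes z :: "int \<Rightarrow> int ^ 'd"
  assumes "finite I" "M > 0" and "\<And>k. k \<in> I \<Longrightarrow> \<exists>l\<in>{1..L}. z l \<notin> aliasing_set M I k"
  shows "uniquely_reconstructible (cheb_nodes M L z) I"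
  unfolding uniquely_reconstructible_def
proof (intro allI impI ballI)
  fix a b k
  assume eq: "\<forall>x\<in>cheb_nodes M L z. cheb_poly I a x = cheb_poly I b x" and "k \<in> I"
  then obtain l where l: "l \<in> {1..L}" "z l \<notin> aliasing_set M I k"
    using assms(3) by blast
  have "(\<lambda>k. a k - b k) k = 0"
  proof (rule coefficient_zero[OF \<open>finite I\<close> \<open>k \<in> I\<close> \<open>M > 0\<close> l(2)])
    fix j assume "j < M"
    then have "lattice_node (z l) M j \<in> cheb_nodes M L z"
      using l(1) unfolding cheb_nodes_eq by blast
    then show "cheb_poly I (\<lambda>k. a k - b k) (lattice_node (z l) M j) = 0"
      using eq by (simp add: cheb_poly_def left_diff_distrib sum_subtractf)
  qed
  then show "a k = b k" by simp
qed

section \<open>From unique reconstruction to full column rank\<close>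

text \<open>A kernel vector of the matrix is the coefficient vector of a polynomial vanishing on
  \<open>X\<close>, which reconstruction compares with the zero polynomial.\<close>

lemma full_column_rank_if_uniquely_reconstructible:
  fixes X :: "(real ^ 'd) set"
  assumes "finite X" "finite I" and rec: "uniquely_reconstructible X I"
  shows "full_column_rank X I"
  unfolding full_column_rank_def
proof (intro conjI allI impI)
  fix xs :: "(real ^ 'd) list" and ks
  assume "distinct xs \<and> set xs = X \<and> distinct ks \<and> set ks = I"
  then have xs: "set xs = X" and ks: "distinct ks" "set ks = I" by auto
  define C where "C = cheb_matrix xs ks"
  have C: "C \<in> carrier_mat (length xs) (length ks)"
    by (simp add: C_def cheb_matrix_def)
  have col_C: "col C j = vec (length xs) (\<lambda>i. cheb (ks ! j) (xs ! i))" if "j < length ks" for j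
    using that by (intro eq_vecI) (simp_all add: C_def cheb_matrix_def)
  define e where "e k' k = (if k = k' then 1 else 0 :: real)" for k' k :: "nat ^ 'd"
  have unit: "cheb_poly I (e k') x = cheb k' x" if "k' \<in> I" for k' x
    using that \<open>finite I\<close> unfolding cheb_poly_def e_def
    by (subst sum.remove[of _ k']) auto
  \<comment> \<open>Linear independence is a property of the set of columns, which forgets
    repetitions. Two equal columns would identify two unit coefficient families
    \<open>e\<close>.\<close>
  have dist: "distinct (cols C)"
    unfolding distinct_conv_nth
  proof (intro allI impI)
    fix i j assume "i < length (cols C)" "j < length (cols C)" "i \<noteq> j"
    then have ij: "i < length ks" "j < length ks" "ks ! i \<noteq> ks ! j"
      using C ks(1) by (auto simp: nth_eq_iff_index_eq)
    show "cols C ! i \<noteq> cols C ! j"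
    proof
      assume "cols C ! i = cols C ! j"
      then have "vec (length xs) (\<lambda>r. cheb (ks ! i) (xs ! r)) = vec (length xs) (\<lambda>r. cheb (ks ! j) (xs ! r))"
        using C ij by (simp add: col_C)
      then have "cheb (ks ! i) (xs ! r) = cheb (ks ! j) (xs ! r)" if "r < length xs" for r
        using that by (metis index_vec)
      then have "\<forall>x\<in>X. cheb (ks ! i) x = cheb (ks ! j) x"
        using xs by (metis in_set_conv_nth)
      moreover have "ks ! i \<in> I" "ks ! j \<in> I"
        using ij ks(2) nth_mem by blast+
      ultimately have "\<forall>x\<in>X. cheb_poly I (e (ks ! i)) x = cheb_poly I (e (ks ! j)) x"
        by (simp add: unit)
      then have "\<forall>k\<in>I. e (ks ! i) k = e (ks ! j) k"
        using rec unfolding uniquely_reconstructible_def by blast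
      then show False
        using \<open>ks ! i \<in> I\<close> ij(3) by (auto simp: e_def)
    qed
  qed
  have "\<not> module.lin_dep class_ring (module_vec TYPE(real) (length xs)) (set (cols C))"
  proof
    assume "module.lin_dep class_ring (module_vec TYPE(real) (length xs)) (set (cols C))"
    then obtain v where v: "v \<in> carrier_vec (length ks)" "v \<noteq> 0\<^sub>v (length ks)"
      and Cv: "C *\<^sub>v v = 0\<^sub>v (length xs)"
      using vec_space.lin_depE[OF C _ dist] by blast
    \<comment> \<open>Inverting the enumeration \<open>ks\<close> turns a vector indexed by
      positions into a coefficient family on \<open>I\<close>.\<close>
    define a where "a k = vec_index v (the_inv_into {..<length ks} ((!) ks) k)" for k
    have inj: "inj_on ((!) ks) {..<length ks}"
      using ks(1) by (simp add: inj_on_nth)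
    have a_nth: "a (ks ! j) = vec_index v j" if "j < length ks" for j
      using that by (simp add: a_def the_inv_into_f_f[OF inj])
    have I_eq: "I = (!) ks ` {..<length ks}"
      using ks(2) by (auto simp: set_conv_nth)
    have "cheb_poly I a (xs ! r) = 0" if "r < length xs" for r
    proof -
      have "cheb_poly I a (xs ! r) = (\<Sum>j<length ks. a (ks ! j) * cheb (ks ! j) (xs ! r))"
        unfolding cheb_poly_def I_eq by (simp add: sum.reindex[OF inj])
      also have "\<dots> = vec_index (C *\<^sub>v v) r"
        using that v(1) by (simp add: C_def cheb_matrix_def scalar_prod_def a_nth lessThan_atLeast0 mult.commute)
      finally show ?thesis
        using Cv that by simp
    qed
    then have "\<forall>x\<in>X. cheb_poly I a x = cheb_poly I (\<lambda>_. 0) x"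
      using xs by (auto simp: in_set_conv_nth cheb_poly_def)
    then have "\<forall>k\<in>I. a k = 0"
      using rec unfolding uniquely_reconstructible_def by blast
    then have "vec_index v j = 0" if "j < length ks" for j
      using that a_nth I_eq by auto
    then have "v = 0\<^sub>v (length ks)"
      using v(1) by (intro eq_vecI) auto
    with v(2) show False ..
  qed
  then have "vec_space.rank (length xs) C = length ks"
    by (rule vec_space.lin_indpt_full_rank[OF C dist])
  then show "vec_space.rank (length xs) (cheb_matrix xs ks) = card I"
    using ks by (simp add: C_def distinct_card[symmetric])
qed (use assms in auto)

section \<open>Counting the generating vectors that alias\<close>

lemma residue_box_eq: "residue_box M = vec_lambda ` (\<Pi>\<^sub>E i\<in>UNIV. {0..int M - 1})"
proof (intro equalityI subsetI)
  fix v :: "int ^ 'd" assume "v \<in> residue_box M"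
  then show "v \<in> vec_lambda ` (\<Pi>\<^sub>E i\<in>UNIV. {0..int M - 1})"
    by (intro image_eqI[of _ _ "vec_nth v"]) (auto simp: residue_box_def)
qed (auto simp: residue_box_def)

lemma finite_residue_box: "finite (residue_box M)"
  unfolding residue_box_eq by (intro finite_imageI finite_PiE) auto

lemma residue_box_nonempty: "M > 0 \<Longrightarrow> residue_box M \<noteq> {}"
  by (auto simp: residue_box_def intro!: exI[of _ "\<chi> i. 0"])

text \<open>Translating the coordinate \<open>i\<close> of a solution by \<open>t\<close> shifts the linear form by \<open>g\<^sub>i t\<close>,
  so the \<open>M\<close> translates of the solution set are disjoint.\<close>

lemma card_solutions_le:
  fixes g :: "int ^ 'd"
  assumes "prime M" and i: "\<not> int M dvd g $ i"
  shows "card (residue_box M \<inter> {v. int M dvd (\<Sum>i\<in>UNIV. g $ i * v $ i)}) * M \<le> card (residue_box M :: (int ^ 'd) set)"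
proof -
  have M: "M > 0" "prime (int M)"
    using assms(1) prime_gt_0_nat by auto
  define s where "s v = (\<Sum>i\<in>UNIV. g $ i * v $ i)" for v :: "int ^ 'd"
  define B where "B = residue_box M \<inter> {v :: int ^ 'd. int M dvd s v}"
  define shift where "shift = (\<lambda>(v :: int ^ 'd, t). \<chi> j. if j = i then (v $ i + t) mod int M else v $ j)"
  have s_shift: "[s (shift (v, t)) = g $ i * t] (mod int M)" if "v \<in> B" for v t
  proof -
    have "s (shift (v, t)) = s v + g $ i * ((v $ i + t) mod int M - v $ i)"
      unfolding s_def shift_def by (simp add: sum.remove[of UNIV i] algebra_simps)
    moreover have "[s v + g $ i * ((v $ i + t) mod int M - v $ i) = 0 + g $ i * ((v $ i + t) - v $ i)] (mod int M)"
      using that by (intro cong_add cong_mult cong_diff) (auto simp: B_def cong_0_iff)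
    ultimately show ?thesis by simp
  qed
  have "inj_on shift (B \<times> {0..<int M})"
  proof (rule inj_onI, clarify)
    fix v t v' t'
    assume v: "v \<in> B" "v' \<in> B" and t: "t \<in> {0..<int M}" "t' \<in> {0..<int M}"
      and eq: "shift (v, t) = shift (v', t')"
    have "[g $ i * t = g $ i * t'] (mod int M)"
      using s_shift[OF v(1), of t] s_shift[OF v(2), of t'] eq by (metis cong_sym cong_trans)
    \<comment> \<open>Primality makes \<open>g $ i\<close> invertible modulo \<open>M\<close>, so
      the value of \<open>s\<close> determines the translation \<open>t\<close>.\<close>
    moreover have "coprime (g $ i) (int M)"
      using M(2) i by (simp add: prime_imp_coprime coprime_commute)
    ultimately have "[t = t'] (mod int M)"
      by (simp add: cong_mult_lcancel)
    then have tt: "t = t'"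
      using t by (simp add: cong_def)
    have "(v $ i + t) mod int M = (v' $ i + t) mod int M"
      using arg_cong[OF eq, of "\<lambda>w. w $ i"] by (simp add: shift_def tt)
    then have "[v $ i = v' $ i] (mod int M)"
      by (simp add: cong_def[symmetric] cong_add_rcancel)
    moreover have "v $ i \<in> {0..<int M}" "v' $ i \<in> {0..<int M}"
      using v by (auto simp: B_def residue_box_def)
    ultimately have "v $ i = v' $ i"
      by (simp add: cong_def)
    moreover have "v $ j = v' $ j" if "j \<noteq> i" for j
      using arg_cong[OF eq, of "\<lambda>w. w $ j"] that by (simp add: shift_def)
    ultimately have "v = v'"
      by (metis Finite_Cartesian_Product.vec_eq_iff)
    with tt show "v = v' \<and> t = t'" by simp
  qed
  moreover have "shift ` (B \<times> {0..<int M}) \<subseteq> residue_box M"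
    using M(1) by (auto simp: shift_def B_def residue_box_def)
  ultimately have "card (B \<times> {0..<int M}) \<le> card (residue_box M :: (int ^ 'd) set)"
    using finite_residue_box by (rule card_inj_on_le)
  then show ?thesis
    by (simp add: card_cartesian_product B_def s_def)
qed

lemma finite_mirrored:
  fixes I :: "(nat ^ 'd) set"
  assumes "finite I"
  shows "finite (mirrored I)"
proof -
  have "finite {l :: int ^ 'd. \<forall>j. l $ j \<in> {-1, 1}}"
  proof (rule finite_subset)
    show "{l :: int ^ 'd. \<forall>j. l $ j \<in> {-1, 1}} \<subseteq> vec_lambda ` (\<Pi>\<^sub>E j\<in>UNIV. {-1, 1})"
    proof
      fix l :: "int ^ 'd" assume "l \<in> {l. \<forall>j. l $ j \<in> {-1, 1}}"
      then show "l \<in> vec_lambda ` (\<Pi>\<^sub>E j\<in>UNIV. {-1, 1})"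
        by (intro image_eqI[of _ _ "vec_nth l"]) auto
    qed
  qed (intro finite_imageI finite_PiE; simp)
  moreover have "mirrored I = (\<lambda>(k, l). \<chi> j. l $ j * int (k $ j)) ` (I \<times> {l. \<forall>j. l $ j \<in> {-1, 1}})"
    by (auto simp: mirrored_def)
  ultimately show ?thesis
    using assms by simp
qed

text \<open>Union bound over the frequencies \<open>h\<close>. Since reduction modulo
  \<open>M\<close> is injective on the mirrored set, \<open>h\<close> and \<open>k\<close> differ
  modulo \<open>M\<close> in some coordinate, and the solution count applies to their
  difference.\<close>

lemma card_aliasing_le:
  fixes I :: "(nat ^ 'd) set"
  assumes "finite I" "k \<in> I" "prime M"
    and modM: "card (mod_set (mirrored I) M) = card (mirrored I)"
  shows "card (residue_box M \<inter> aliasing_set M I k) * M \<le> (card (mirrored I) - 1) * card (residue_box M :: (int ^ 'd) set)"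
proof -
  define J where "J = mirrored I - mirrored {k}"
  define A where "A h = residue_box M \<inter> {v. int M dvd (\<Sum>i\<in>UNIV. (h - signed_vec UNIV k) $ i * v $ i)}" for h :: "int ^ 'd"
  have kI: "signed_vec UNIV k \<in> mirrored I" "signed_vec UNIV k \<in> mirrored {k}"
    using \<open>k \<in> I\<close> by (simp_all add: signed_vec_in_mirrored)
  have finJ: "finite J"
    using finite_mirrored[OF \<open>finite I\<close>] by (simp add: J_def)
  \<comment> \<open>At least the all-plus vector of \<open>k\<close> is missing from
    \<open>J\<close>; this is where the \<open>- 1\<close> comes from.\<close>
  have "card J \<le> card (mirrored I - {signed_vec UNIV k})"
    using kI finite_mirrored[OF \<open>finite I\<close>] unfolding J_def by (intro card_mono) auto
  then have cardJ: "card J \<le> card (mirrored I) - 1"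
    using kI finite_mirrored[OF \<open>finite I\<close>] by simp
  have inj: "inj_on (\<lambda>h. \<chi> j. h $ j mod int M) (mirrored I)"
    using modM finite_mirrored[OF \<open>finite I\<close>] unfolding mod_set_def by (intro eq_card_imp_inj_on)
  have A_le: "card (A h) * M \<le> card (residue_box M :: (int ^ 'd) set)" if "h \<in> J" for h
  proof -
    have "h \<in> mirrored I" "h \<noteq> signed_vec UNIV k"
      using that kI by (auto simp: J_def)
    then have "(\<chi> j. h $ j mod int M) \<noteq> (\<chi> j. signed_vec UNIV k $ j mod int M)"
      using inj_onD[OF inj _ _ kI(1)] by blast
    then obtain i where "h $ i mod int M \<noteq> signed_vec UNIV k $ i mod int M"
      by (auto simp: Finite_Cartesian_Product.vec_eq_iff)
    then have "\<not> int M dvd (h - signed_vec UNIV k) $ i"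
      by (simp add: mod_eq_dvd_iff)
    then show ?thesis
      unfolding A_def by (rule card_solutions_le[OF \<open>prime M\<close>])
  qed
  have "residue_box M \<inter> aliasing_set M I k = (\<Union>h\<in>J. A h)"
    by (auto simp: aliasing_set_def J_def A_def signed_vec_UNIV)
  then have "card (residue_box M \<inter> aliasing_set M I k) * M \<le> (\<Sum>h\<in>J. card (A h)) * M"
    using card_UN_le[OF finJ, of A] by simp
  also have "\<dots> \<le> (\<Sum>h\<in>J. card (residue_box M :: (int ^ 'd) set))"
    unfolding sum_distrib_right using A_le by (rule sum_mono)
  also have "\<dots> \<le> (card (mirrored I) - 1) * card (residue_box M :: (int ^ 'd) set)"
    using cardJ by simp
  finally show ?thesis .
qed

lemma prob_aliasing_le:
  fixes I :: "(nat ^ 'd) set"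
  assumes "finite I" "k \<in> I" "prime M" "c > 0"
    and "card (mod_set (mirrored I) M) = card (mirrored I)"
    and M_ge: "real M \<ge> c * (real (card (mirrored I)) - 1)"
  shows "measure (measure_pmf (pmf_of_set (residue_box M))) (aliasing_set M I k) \<le> 1 / c"
proof -
  have "M > 0"
    using \<open>prime M\<close> prime_gt_0_nat by simp
  define b where "b = card (residue_box M :: (int ^ 'd) set)"
  define a where "a = card (residue_box M \<inter> aliasing_set M I k)"
  have "b > 0"
    using \<open>M > 0\<close> by (simp add: b_def card_gt_0_iff residue_box_nonempty finite_residue_box)
  have "mirrored I \<noteq> {}"
    using signed_vec_in_mirrored[OF \<open>k \<in> I\<close>] by blast
  then have "card (mirrored I) \<ge> 1"
    using finite_mirrored[OF \<open>finite I\<close>] by (simp add: Suc_le_eq card_gt_0_iff)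
  \<comment> \<open>Subtraction on naturals is truncated; it is exact here because the mirrored set
    is nonempty.\<close>
  then have card1: "real (card (mirrored I) - 1) = real (card (mirrored I)) - 1"
    by simp
  have "real a * real M \<le> real (card (mirrored I) - 1) * real b"
    using card_aliasing_le[OF assms(1-3,5)] unfolding a_def b_def by (metis of_nat_le_iff of_nat_mult)
  then have "c * (real a * real M) \<le> (c * (real (card (mirrored I)) - 1)) * real b"
    using \<open>c > 0\<close> card1 by simp
  also have "\<dots> \<le> real M * real b"
    using M_ge by (rule mult_right_mono) simp
  finally have "real M * (c * real a) \<le> real M * real b"
    by (simp add: ac_simps)
  then have "real a / real b \<le> 1 / c"
    using \<open>M > 0\<close> \<open>b > 0\<close> \<open>c > 0\<close> by (simp add: field_simps)
  then show ?thesis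
    using \<open>M > 0\<close>
    by (simp add: measure_pmf_of_set residue_box_nonempty finite_residue_box a_def b_def)
qed

section \<open>The number of lattices needed\<close>

lemma two_mult_square_le_ln:
  fixes c :: real
  assumes "c > 1"
  shows "2 * ((c - 1) / c)\<^sup>2 \<le> ln c"
proof -
  define f where "f u = ln u - 2 * ((u - 1) / u)\<^sup>2" for u :: real
  have "f 1 \<le> f c"
  proof (rule DERIV_nonneg_imp_nondecreasing[of 1 c f])
    fix u :: real assume "1 \<le> u"
    then have "(f has_real_derivative (1 / u - 4 * (u - 1) / u ^ 3)) (at u)"
      unfolding f_def
      by (auto intro!: derivative_eq_intros simp: field_simps power2_eq_square power3_eq_cube)
    \<comment> \<open>The numerator is the perfect square \<open>u^2 - 4 * u + 4\<close>, so
      \<open>f\<close> increases from \<open>f 1 = 0\<close>.\<close>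
    moreover have "1 / u - 4 * (u - 1) / u ^ 3 = (u - 2)\<^sup>2 / u ^ 3"
      using \<open>1 \<le> u\<close> by (simp add: field_simps power2_eq_square power3_eq_cube)
    ultimately show "\<exists>y. (f has_real_derivative y) (at u) \<and> 0 \<le> y"
      using \<open>1 \<le> u\<close> by auto
  qed (use assms in simp)
  then show ?thesis by (simp add: f_def)
qed

lemma union_bound_le:
  fixes c \<delta> n :: real and L :: int
  assumes "c > 1" "0 < \<delta>" "\<delta> \<le> 1" "n \<ge> 1"
    and L: "L \<ge> \<lceil>(c / (c - 1))\<^sup>2 * ((ln n - ln \<delta>) / 2)\<rceil>"
  shows "n * (1 / c) ^ nat L \<le> \<delta>"
proof -
  have ln_nonneg: "0 \<le> ln n - ln \<delta>"
    using assms by (smt (verit) ln_ge_zero ln_le_zero_iff)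
  have Lr: "real_of_int L \<ge> (c / (c - 1))\<^sup>2 * ((ln n - ln \<delta>) / 2)"
    using L by (simp add: ceiling_le_iff)
  \<comment> \<open>Nonnegativity ensures that \<open>nat L\<close> does not truncate
    \<open>L\<close>.\<close>
  then have "real_of_int L \<ge> 0"
    using ln_nonneg by (smt (verit) divide_nonneg_pos mult_nonneg_nonneg zero_le_power2)
  have "ln n - ln \<delta> = (2 * ((c - 1) / c)\<^sup>2) * ((c / (c - 1))\<^sup>2 * ((ln n - ln \<delta>) / 2))"
    using \<open>c > 1\<close> by (simp add: power_divide)
  also have "\<dots> \<le> ln c * real_of_int L"
    using two_mult_square_le_ln[OF \<open>c > 1\<close>] Lr ln_nonneg \<open>c > 1\<close> by (intro mult_mono) auto
  finally have "ln n - ln \<delta> \<le> ln (c ^ nat L)"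
    using \<open>c > 1\<close> \<open>real_of_int L \<ge> 0\<close> by (simp add: ln_realpow mult.commute)
  then have "ln n \<le> ln (\<delta> * c ^ nat L)"
    using assms by (simp add: ln_mult)
  then have "n \<le> \<delta> * c ^ nat L"
    using assms by simp
  then show ?thesis
    using \<open>c > 1\<close> by (simp add: power_divide field_simps)
qed

section \<open>Measurability and independence\<close>

text \<open>As \<open>Q\<close> only looks at finitely many countably valued variables, the event is
  a countable union of events that prescribe all of them.\<close>

lemma sets_Collect_countable_family:
  fixes z :: "'l \<Rightarrow> 'w \<Rightarrow> 'v :: countable"
  assumes "finite A" and rv: "\<And>l. l \<in> A \<Longrightarrow> z l \<in> measurable N (count_space UNIV)"
    and cong: "\<And>f g. (\<And>l. l \<in> A \<Longrightarrow> f l = g l) \<Longrightarrow> Q f \<Longrightarrow> Q g"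
  shows "{\<omega> \<in> space N. Q (\<lambda>l. z l \<omega>)} \<in> sets N"
proof -
  \<comment> \<open>Extensional functions are fixed outside \<open>A\<close>, which makes
    \<open>F\<close> countable; \<open>cong\<close> allows passing to the restriction.\<close>
  define F where "F = {f \<in> (\<Pi>\<^sub>E l\<in>A. UNIV). Q f}"
  have "countable F"
    unfolding F_def by (rule countable_subset[OF _ countable_PiE[OF \<open>finite A\<close>]]) auto
  moreover have "{\<omega> \<in> space N. \<forall>l\<in>A. z l \<omega> = f l} \<in> sets N" for f
  proof (cases "A = {}")
    case False
    show ?thesis
      using _ \<open>finite A\<close> False
    proof (rule sets.sets_Collect_finite_All')
      fix l assume "l \<in> A"
      have "z l -` {f l} \<inter> space N \<in> sets N"
        by (rule measurable_sets[OF rv[OF \<open>l \<in> A\<close>]]) simp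
      then show "{\<omega> \<in> space N. z l \<omega> = f l} \<in> sets N"
        by (simp add: vimage_def Int_def conj_commute)
    qed
  qed simp
  moreover have "{\<omega> \<in> space N. Q (\<lambda>l. z l \<omega>)} = (\<Union>f\<in>F. {\<omega> \<in> space N. \<forall>l\<in>A. z l \<omega> = f l})"
  proof (intro equalityI subsetI)
    fix \<omega> assume \<omega>: "\<omega> \<in> {\<omega> \<in> space N. Q (\<lambda>l. z l \<omega>)}"
    then have "restrict (\<lambda>l. z l \<omega>) A \<in> F"
      using cong[of "\<lambda>l. z l \<omega>" "restrict (\<lambda>l. z l \<omega>) A"] by (simp add: F_def)
    then show "\<omega> \<in> (\<Union>f\<in>F. {\<omega> \<in> space N. \<forall>l\<in>A. z l \<omega> = f l})"
      using \<omega> by (intro UN_I) auto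
  next
    fix \<omega> assume "\<omega> \<in> (\<Union>f\<in>F. {\<omega> \<in> space N. \<forall>l\<in>A. z l \<omega> = f l})"
    then obtain f where "Q f" "\<omega> \<in> space N" "\<forall>l\<in>A. z l \<omega> = f l"
      by (auto simp: F_def)
    then show "\<omega> \<in> {\<omega> \<in> space N. Q (\<lambda>l. z l \<omega>)}"
      using cong[of f "\<lambda>l. z l \<omega>"] by simp
  qed
  ultimately show ?thesis
    by (auto intro!: sets.countable_UN'')
qed

lemma (in prob_space) prob_all_in_le_power:
  assumes "finite A" and indep: "indep_vars (\<lambda>_. count_space UNIV) z A"
    and p: "\<And>l. l \<in> A \<Longrightarrow> measure (distr M (count_space UNIV) (z l)) B \<le> p"
  shows "prob {\<omega> \<in> space M. \<forall>l\<in>A. z l \<omega> \<in> B} \<le> p ^ card A"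
\<comment> \<open>The empty family does occur: for \<open>card I = 1\<close> and \<delta> = 1 the
  value \<open>L = 0\<close> is allowed. The bound is then 1.\<close>
proof (cases "A = {}")
  case False
  have rv: "z l \<in> measurable M (count_space UNIV)" if "l \<in> A" for l
    using indep that by (auto simp: indep_vars_def)
  have "{\<omega> \<in> space M. \<forall>l\<in>A. z l \<omega> \<in> B} = (\<Inter>l\<in>A. z l -` B \<inter> space M)"
    using False by auto
  then have "prob {\<omega> \<in> space M. \<forall>l\<in>A. z l \<omega> \<in> B} = (\<Prod>l\<in>A. prob (z l -` B \<inter> space M))"
    using indep_varsD_finite[OF indep False \<open>finite A\<close>, of "\<lambda>_. B"] by simp
  also have "\<dots> \<le> (\<Prod>l\<in>A. p)"
    using p rv by (intro prod_mono) (auto simp: measure_distr)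
  finally show ?thesis by simp
qed simp

theorem theorem4p3:
  fixes I :: "(nat ^ 'd) set"
    and c \<delta> lam :: real
    and L :: int
    and M :: nat
    and N :: "'w measure"
    and z :: "int \<Rightarrow> 'w \<Rightarrow> int ^ 'd"
  assumes "finite I" and "I \<noteq> {}"
    and "c > 1" and "0 < \<delta>" and "\<delta> \<le> 1"
    and "lam \<ge> c * (real (card (mirrored I)) - 1)"
    and "L \<ge> \<lceil>(c / (c - 1))\<^sup>2 * ((ln (real (card I)) - ln \<delta>) / 2)\<rceil>"
    and "prime M" and "real M \<ge> lam"
    and "card (mod_set (mirrored I) M) = card (mirrored I)"
    and "prob_space N"
    and "prob_space.indep_vars N (\<lambda>_. count_space UNIV) z {1..L}"
    and "\<And>l. l \<in> {1..L} \<Longrightarrow>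
           distr N (count_space UNIV) (z l) = measure_pmf (pmf_of_set (residue_box M))"
  shows "measure N {\<omega> \<in> space N.
           uniquely_reconstructible (cheb_nodes M L (\<lambda>l. z l \<omega>)) I \<and>
           full_column_rank (cheb_nodes M L (\<lambda>l. z l \<omega>)) I} \<ge> 1 - \<delta>"
proof -
  interpret prob_space N by fact
  have "M > 0"
    using \<open>prime M\<close> prime_gt_0_nat by simp
  define good where "good f \<longleftrightarrow> uniquely_reconstructible (cheb_nodes M L f) I \<and>
    full_column_rank (cheb_nodes M L f) I" for f :: "int \<Rightarrow> int ^ 'd"
  define bad where "bad k = {\<omega> \<in> space N. \<forall>l\<in>{1..L}. z l \<omega> \<in> aliasing_set M I k}" for k
  have rv: "z l \<in> measurable N (count_space UNIV)" if "l \<in> {1..L}" for l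
    using assms(12) that by (auto simp: indep_vars_def)
  \<comment> \<open>Monotonicity of the measure below needs the larger event to be measurable. The
    nodes depend only on the vectors with index in \<open>{1..L}\<close>.\<close>
  have good_sets: "{\<omega> \<in> space N. good (\<lambda>l. z l \<omega>)} \<in> events"
  proof (rule sets_Collect_countable_family[where A = "{1..L}" and Q = good])
    fix f g :: "int \<Rightarrow> int ^ 'd"
    assume "\<And>l. l \<in> {1..L} \<Longrightarrow> f l = g l" "good f"
    moreover from this(1) have "cheb_nodes M L f = cheb_nodes M L g"
      by (simp add: cheb_nodes_def)
    ultimately show "good g" by (simp add: good_def)
  qed (simp_all add: rv)
  have bad_sets: "bad k \<in> events" for k
    unfolding bad_def
    by (rule sets_Collect_countable_family[where A = "{1..L}" and Q = "\<lambda>f. \<forall>l\<in>{1..L}. f l \<in> aliasing_set M I k"])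
      (simp_all add: rv)
  have "prob (bad k) \<le> (1 / c) ^ nat L" if "k \<in> I" for k
  proof -
    have "measure (distr N (count_space UNIV) (z l)) (aliasing_set M I k) \<le> 1 / c" if "l \<in> {1..L}" for l
      unfolding assms(13)[OF that]
      using assms(1,3,6,8-10) \<open>k \<in> I\<close> by (intro prob_aliasing_le) auto
    then have "prob (bad k) \<le> (1 / c) ^ card {1..L}"
      unfolding bad_def by (intro prob_all_in_le_power[OF _ assms(12)]) auto
    then show ?thesis by simp
  qed
  then have "prob (\<Union>k\<in>I. bad k) \<le> (\<Sum>k\<in>I. (1 / c) ^ nat L)"
    using finite_measure_subadditive_finite[OF \<open>finite I\<close>, of bad] bad_sets
    by (meson image_subsetI order_trans sum_mono)
  also have "\<dots> = real (card I) * (1 / c) ^ nat L"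
    by simp
  also have "\<dots> \<le> \<delta>"
    using assms(1-5,7) by (intro union_bound_le) (auto simp: Suc_le_eq card_gt_0_iff)
  finally have "1 - \<delta> \<le> prob (space N - (\<Union>k\<in>I. bad k))"
    using bad_sets \<open>finite I\<close> by (subst prob_compl) auto
  also have "\<dots> \<le> prob {\<omega> \<in> space N. good (\<lambda>l. z l \<omega>)}"
  \<comment> \<open>Outside all \<open>bad k\<close>, every \<open>k\<close> has at least one
    lattice without aliasing, which yields reconstruction and then the rank.\<close>
  proof (rule finite_measure_mono[OF _ good_sets], clarify)
    fix \<omega> assume "\<omega> \<in> space N" "\<omega> \<notin> (\<Union>k\<in>I. bad k)"
    then have "uniquely_reconstructible (cheb_nodes M L (\<lambda>l. z l \<omega>)) I"
      using \<open>finite I\<close> \<open>M > 0\<close> by (intro uniquely_reconstructible_if_not_aliasing) (auto simp: bad_def)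
    moreover have "finite (cheb_nodes M L (\<lambda>l. z l \<omega>))"
      by (simp add: cheb_nodes_eq)
    ultimately show "good (\<lambda>l. z l \<omega>)"
      using \<open>finite I\<close> full_column_rank_if_uniquely_reconstructible by (auto simp: good_def)
  qed
  finally show ?thesis
    unfolding good_def .
qed

end
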